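(* Let $m\ge 1$, let $G\subset\mathbb{R}^{n_0}\times\mathbb{R}^{n_1}\times\dots\times\mathbb{R}^{n_m}$ be nonempty, and for $i\in\{1,\dots,m\}$ let $F_i\subset\mathbb{R}^{n_0}\times\mathbb{R}^{n_i}$ and let $g_i$ be the real-valued objective function of player $i$ (with notation and domains as in the context). Assume: (i) for all $x\in\pi_0(\hat F\cap G)$, $g^N(x)>-\infty$; (ii) for any $(x,y)\in\hat F\cap G$ and any index $j\in\{1,\dots,m\}$, $$\{y_j' : (x,y_j')\in F_j\}\subset \pi_j\big(\{(x',y_1',\dots,y_m')\in\hat F\cap G : y_i'=y_i\ \ \forall i\neq j\}\big).$$ Then any normalized Nash equilibrium (NNE) is a generalized Nash equilibrium (GNE).
   Context: Write $y=(y_1,\dots,y_m)$ with $y_i\in\mathbb{R}^{n_i}$, and $x\in\mathbb{R}^{n_0}$. Define $$\hat F=\{(x,y_1,\dots,y_m) : (x,y_i)\in F_i\ \ \forall i\in\{1,\dots,m\}\}.$$ The projections are $\pi_0(x,y_1,\dots,y_m)=x$, $\pi_{-0}(x,y_1,\dots,y_m)=(y_1,\dots,y_m)$, and $\pi_j(x,y_1,\dots,y_m)=y_j$ for $j\in\{1,\dots,m\}$. Each $g_i$ is a real-valued function $g_i:D_i\to\mathbb{R}$, where $D_i\subset\mathbb{R}^{n_0}\times\mathbb{R}^{n_i}$ contains $F_i$ and all points $(x,y_i')$ with $x\in\pi_0(\hat F\cap G)$ and $y'\in\pi_{-0}(\hat F\cap G)$. For $x\in\pi_0(\hat F\cap G)$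 define $$g^N(x)=\inf_{y'}\Big\{\sum_{i=1}^m g_i(x,y_i') : y'\in\pi_{-0}(\hat F\cap G)\Big\}.$$ Player $i$'s solution set, parametric in $x$, is $S_i(x)=\arg\min_{y_i}\{g_i(x,y_i):(x,y_i)\in F_i\}$. A point $(x^*,y_1^*,\dots,y_m^* )$ is a generalized Nash equilibrium (GNE) if $(x^*,y_1^*,\dots,y_m^* )\in G$ and $y_i^*\in S_i(x^* )$ for each $i$. A point $(x^*,y^* )$ is a normalized Nash equilibrium (NNE) if $(x^*,y^* )\in\hat F\cap G$ and $\sum_i g_i(x^*,y_i^* )\le\sum_i g_i(x^*,y_i')$ for all $(x',y')\in\hat F\cap G$. *)

theory Defs
  imports
    Complex_Main
    "HOL-Library.FuncSet"
    "HOL-Library.Extended_Real"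
    "Jordan_Normal_Form.Matrix"
begin

text \<open>
  The dimensions \<open>n 0, n 1, \<dots>, n m\<close> may all differ, so \<open>\<real>^k\<close> is the carrier
  \<open>carrier_vec k\<close> of the type of real vectors. A point \<open>(x, y\<^sub>1, \<dots>, y\<^sub>m)\<close> is a pair
  \<open>(x, y)\<close> where \<open>y\<close> is an extensional function on the player indices \<open>{1..m}\<close>.
\<close>

definition joint_space :: "nat \<Rightarrow> (nat \<Rightarrow> nat) \<Rightarrow> (real vec \<times> (nat \<Rightarrow> real vec)) set" where
  "joint_space m n = carrier_vec (n 0) \<times> (\<Pi>\<^sub>E i\<in>{1..m}. carrier_vec (n i))"

definition player_space :: "(nat \<Rightarrow> nat) \<Rightarrow> nat \<Rightarrow> (real vec \<times> real vec) set" where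
  "player_space n i = carrier_vec (n 0) \<times> carrier_vec (n i)"

definition Fhat ::
  "nat \<Rightarrow> (nat \<Rightarrow> nat) \<Rightarrow> (nat \<Rightarrow> (real vec \<times> real vec) set) \<Rightarrow> (real vec \<times> (nat \<Rightarrow> real vec)) set" where
  "Fhat m n F = {(x, y) \<in> joint_space m n. \<forall>i\<in>{1..m}. (x, y i) \<in> F i}"

text \<open>The projections \<open>\<pi>\<^sub>0\<close> and \<open>\<pi>\<^sub>-\<^sub>0\<close> are \<^const>\<open>fst\<close> and \<^const>\<open>snd\<close>.\<close>

definition proj :: "nat \<Rightarrow> real vec \<times> (nat \<Rightarrow> real vec) \<Rightarrow> real vec" where
  "proj j p = snd p j"

definition total_objective ::
  "nat \<Rightarrow> (nat \<Rightarrow> real vec \<times> real vec \<Rightarrow> real) \<Rightarrow> real vec \<Rightarrow> (nat \<Rightarrow> real vec) \<Rightarrow> real" where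
  "total_objective m g x y = (\<Sum>i=1..m. g i (x, y i))"

definition gN ::
  "nat \<Rightarrow> (nat \<Rightarrow> nat) \<Rightarrow> (nat \<Rightarrow> (real vec \<times> real vec) set) \<Rightarrow> (real vec \<times> (nat \<Rightarrow> real vec)) set
    \<Rightarrow> (nat \<Rightarrow> real vec \<times> real vec \<Rightarrow> real) \<Rightarrow> real vec \<Rightarrow> ereal" where
  "gN m n F G g x = (INF y'\<in>snd ` (Fhat m n F \<inter> G). ereal (total_objective m g x y'))"

definition solution_set ::
  "(nat \<Rightarrow> (real vec \<times> real vec) set) \<Rightarrow> (nat \<Rightarrow> real vec \<times> real vec \<Rightarrow> real)
    \<Rightarrow> nat \<Rightarrow> real vec \<Rightarrow> real vec set" where
  "solution_set F g i x = {z. is_arg_min (\<lambda>z. g i (x, z)) (\<lambda>z. (x, z) \<in> F i) z}"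

definition GNE ::
  "nat \<Rightarrow> (nat \<Rightarrow> (real vec \<times> real vec) set) \<Rightarrow> (real vec \<times> (nat \<Rightarrow> real vec)) set
    \<Rightarrow> (nat \<Rightarrow> real vec \<times> real vec \<Rightarrow> real) \<Rightarrow> real vec \<times> (nat \<Rightarrow> real vec) \<Rightarrow> bool" where
  "GNE m F G g = (\<lambda>(x, y). (x, y) \<in> G \<and> (\<forall>i\<in>{1..m}. y i \<in> solution_set F g i x))"

text \<open>
  The component \<open>x'\<close> of the competing point does not enter the objective: both sums are
  evaluated at the same \<open>x\<close>.
\<close>

definition NNE ::
  "nat \<Rightarrow> (nat \<Rightarrow> nat) \<Rightarrow> (nat \<Rightarrow> (real vec \<times> real vec) set) \<Rightarrow> (real vec \<times> (nat \<Rightarrow> real vec)) set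
    \<Rightarrow> (nat \<Rightarrow> real vec \<times> real vec \<Rightarrow> real) \<Rightarrow> real vec \<times> (nat \<Rightarrow> real vec) \<Rightarrow> bool" where
  "NNE m n F G g = (\<lambda>(x, y). (x, y) \<in> Fhat m n F \<inter> G \<and>
     (\<forall>(x', y')\<in>Fhat m n F \<inter> G. total_objective m g x y \<le> total_objective m g x y'))"

end

theory Submission imports Defs begin

text \<open>
  In a normalized equilibrium all players together minimize the sum of their objectives at the
  fixed shared variable \<open>x\<close>. Suppose that player \<open>j\<close> could improve on \<open>y j\<close> by some \<open>z\<close>
  with \<open>(x, z) \<in> F j\<close>. Hypothesis (ii) completes \<open>z\<close> to a point \<open>(x', y')\<close> of
  \<open>Fhat m n F \<inter> G\<close> in which all other players keep their decisions. The shared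
  variable \<open>x'\<close> may differ from \<open>x\<close>, but this does no harm: the competing sum is still evaluated
  at \<open>x\<close>, so it depends on \<open>y'\<close> only. It then differs from the equilibrium sum in the \<open>j\<close>-th
  term alone, where it is smaller, which contradicts minimality.
\<close>

text \<open>
  The objective is separable, so a unilateral deviation changes the total by exactly the
  deviating player's own change. Hence minimality of the sum passes to each summand.
\<close>

lemma total_objective_unilateral_deviation:
  assumes "j \<in> {1..m}" and "\<And>i. i \<in> {1..m} \<Longrightarrow> i \<noteq> j \<Longrightarrow> y' i = y i"
  shows "total_objective m g x y' - total_objective m g x y = g j (x, y' j) - g j (x, y j)"
proof -
  have "(\<Sum>i\<in>{1..m} - {j}. g i (x, y' i)) = (\<Sum>i\<in>{1..m} - {j}. g i (x, y i))"
    using assms(2) by (intro sum.cong) auto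
  then show ?thesis
    unfolding total_objective_def
    using sum.remove[OF finite_atLeastAtMost assms(1), of "\<lambda>i. g i (x, y' i)"]
      sum.remove[OF finite_atLeastAtMost assms(1), of "\<lambda>i. g i (x, y i)"]
    by linarith
qed

theorem theorem1:
  fixes m :: nat and n :: "nat \<Rightarrow> nat"
    and G :: "(real vec \<times> (nat \<Rightarrow> real vec)) set"
    and F D :: "nat \<Rightarrow> (real vec \<times> real vec) set"
    and g :: "nat \<Rightarrow> real vec \<times> real vec \<Rightarrow> real"
  assumes "m \<ge> 1"
    and "G \<subseteq> joint_space m n" and "G \<noteq> {}"
    and "\<And>i. i \<in> {1..m} \<Longrightarrow> F i \<subseteq> player_space n i"
    and "\<And>i. i \<in> {1..m} \<Longrightarrow> D i \<subseteq> player_space n i"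
    and "\<And>i. i \<in> {1..m} \<Longrightarrow> F i \<subseteq> D i"
    and "\<And>i x y'. i \<in> {1..m} \<Longrightarrow> x \<in> fst ` (Fhat m n F \<inter> G) \<Longrightarrow>
           y' \<in> snd ` (Fhat m n F \<inter> G) \<Longrightarrow> (x, y' i) \<in> D i"
    and "\<And>i. i \<in> {1..m} \<Longrightarrow> g i \<in> D i \<rightarrow>\<^sub>E UNIV"
    and "\<And>x. x \<in> fst ` (Fhat m n F \<inter> G) \<Longrightarrow> gN m n F G g x > - \<infinity>"
    and "\<And>x y j. (x, y) \<in> Fhat m n F \<inter> G \<Longrightarrow> j \<in> {1..m} \<Longrightarrow>
           {z. (x, z) \<in> F j} \<subseteq>
             proj j ` {(x', y') \<in> Fhat m n F \<inter> G. \<forall>i\<in>{1..m}. i \<noteq> j \<longrightarrow> y' i = y i}"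
  shows "\<forall>p. NNE m n F G g p \<longrightarrow> GNE m F G g p"
proof (intro allI impI)
  fix p
  assume nne: "NNE m n F G g p"
  obtain x y where p: "p = (x, y)" by (cases p)
  have xy: "(x, y) \<in> Fhat m n F \<inter> G"
    and min: "\<And>x' y'. (x', y') \<in> Fhat m n F \<inter> G \<Longrightarrow>
      total_objective m g x y \<le> total_objective m g x y'"
    using nne unfolding NNE_def p by auto
  have "y j \<in> solution_set F g j x" if j: "j \<in> {1..m}" for j
  proof -
    have "(x, y j) \<in> F j"
      using xy j by (auto simp: Fhat_def)
    moreover have "g j (x, y j) \<le> g j (x, z)" if "(x, z) \<in> F j" for z
    proof -
      have "z \<in> proj j ` {(x', y') \<in> Fhat m n F \<inter> G. \<forall>i\<in>{1..m}. i \<noteq> j \<longrightarrow> y' i = y i}"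
        using assms(10)[OF xy j] that by blast
      then obtain x' y' where xy': "(x', y') \<in> Fhat m n F \<inter> G"
        and others: "\<And>i. i \<in> {1..m} \<Longrightarrow> i \<noteq> j \<Longrightarrow> y' i = y i"
        and z: "z = y' j"
        by (auto simp: proj_def)
      have "total_objective m g x y' - total_objective m g x y = g j (x, y' j) - g j (x, y j)"
        using j others by (rule total_objective_unilateral_deviation)
      then show ?thesis
        using min[OF xy'] unfolding z by linarith
    qed
    ultimately show ?thesis
      by (auto simp: solution_set_def is_arg_min_linorder)
  qed
  then show "GNE m F G g p"
    using xy unfolding GNE_def p by simp
qed

end
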